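(* Let $\mathcal{X}$ be a compact metric space, $\alpha\in(0,1]$, $x^{(1)},\ldots,x^{(M)}\in\mathcal{X}$, and $\varepsilon\ge0$. For $\Delta:\mathbb{R}^M\to\mathbb{R}$, put $$\mathrm{gwce}_{\boldsymbol{\varepsilon}}(\Delta):=\sup\big\{|\max[f]-\Delta(\mathbf{y})|:\ f\in\mathcal{H}_\alpha,\ y_m=f(x^{(m)})+e_m,\ |e_m|\le\varepsilon,\ m=1,\ldots,M\big\}.$$ Then the minimal global worst-case error for the recovery of the maximum is $$\inf_{\Delta:\mathbb{R}^M\to\mathbb{R}}\mathrm{gwce}_{\boldsymbol{\varepsilon}}(\Delta)=\frac12\max[U]+\varepsilon,\qquad\text{where } U(x)=\min_{1\le m\le M}\mathrm{dist}(x,x^{(m)})^\alpha.$$ Furthermore, the infimum is achieved for the recovery map $$\Delta^{\mathrm{glo}}:\mathbf{y}\in\mathbb{R}^M\mapsto\max_{1\le m\le M}(y_m)+\frac12\max[U]\in\mathbb{R}.$$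
   Context: $\mathcal{H}_\alpha:=\{f:\mathcal{X}\to\mathbb{R} : |f(x)-f(x')|\le\mathrm{dist}(x,x')^\alpha \text{ for all } x,x'\in\mathcal{X}\}$. For a function $g$ on $\mathcal{X}$, $\max[g]:=\max\{g(x):x\in\mathcal{X}\}$. $M\ge1$ and $\mathcal{X}$ is nonempty. *)

theory Defs
  imports "HOL-Analysis.Analysis"
begin

text \<open>The metric space is a subset \<open>X\<close> of a metric type. A function on \<open>X\<close> is represented
  by a total function, and every notion below depends only on its values on \<open>X\<close>. The data
  sites are indexed by a finite type \<open>'m\<close>, so \<open>M\<close> is \<open>CARD('m)\<close>, which is at least 1.\<close>

definition holder_class :: "'a::metric_space set \<Rightarrow> real \<Rightarrow> ('a \<Rightarrow> real) set" where
  "holder_class X \<alpha> = {f. \<forall>x\<in>X. \<forall>x'\<in>X. \<bar>f x - f x'\<bar> \<le> dist x x' powr \<alpha>}"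

text \<open>The greatest element of the image of \<open>X\<close>; meaningful only if the maximum is attained,
  as it is for continuous functions on a nonempty compact set.\<close>

definition max_on :: "'a set \<Rightarrow> ('a \<Rightarrow> real) \<Rightarrow> real" where
  "max_on X g = (GREATEST v. v \<in> g ` X)"

text \<open>Extended real values, since the supremum is infinite for some recovery maps.\<close>

definition gwce ::
  "'a::metric_space set \<Rightarrow> real \<Rightarrow> ('m::finite \<Rightarrow> 'a) \<Rightarrow> real \<Rightarrow> (real ^ 'm \<Rightarrow> real) \<Rightarrow> ereal" where
  "gwce X \<alpha> p \<epsilon> \<Delta> =
    Sup {ereal \<bar>max_on X f - \<Delta> y\<bar> | f e y.
      f \<in> holder_class X \<alpha> \<and> (\<forall>m. y $ m = f (p m) + e m \<and> \<bar>e m\<bar> \<le> \<epsilon>)}"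

definition min_dist_powr :: "real \<Rightarrow> ('m::finite \<Rightarrow> 'a::metric_space) \<Rightarrow> 'a \<Rightarrow> real" where
  "min_dist_powr \<alpha> p x = Min (range (\<lambda>m. dist x (p m) powr \<alpha>))"

definition glo_recovery ::
  "'a::metric_space set \<Rightarrow> real \<Rightarrow> ('m::finite \<Rightarrow> 'a) \<Rightarrow> real ^ 'm \<Rightarrow> real" where
  "glo_recovery X \<alpha> p y = Max (range (\<lambda>m. y $ m)) + max_on X (min_dist_powr \<alpha> p) / 2"

end

theory Submission
  imports Defs
begin

text \<open>For the upper bound, a maximizer of \<open>f\<close> is within \<open>max U\<close> (in \<open>f\<close>-value) of some data site,
  so \<open>max f\<close> lies between \<open>max y - \<epsilon>\<close> and \<open>max y + \<epsilon> + max U\<close>, and \<open>\<Delta>\<close>\<open>glo\<close> picks the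
  midpoint. For the lower bound, the data \<open>y = 0\<close> are produced both by \<open>U + \<epsilon>\<close> and by the
  constant \<open>-\<epsilon>\<close>, whose maxima differ by \<open>max U + 2\<epsilon>\<close>.\<close>

text \<open>With s = a + b, the shares a/s and b/s lie in [0,1], where t \<le>
  \<open>t powr \<alpha>\<close> because \<alpha> \<le> 1. The shares add up to 1, so scaling by
  \<open>s powr \<alpha>\<close> gives the claim. This is what gives
  \<open>dist powr \<alpha>\<close> a triangle inequality.\<close>

lemma powr_add_le_add_powr:
  fixes a b \<alpha> :: real
  assumes "0 \<le> a" "0 \<le> b" "0 < \<alpha>" "\<alpha> \<le> 1"
  shows "(a + b) powr \<alpha> \<le> a powr \<alpha> + b powr \<alpha>"
proof (cases "a + b = 0")
  case False
  define s where "s = a + b"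
  have s: "s > 0" using False assms by (simp add: s_def)
  have frac: "c / s * s powr \<alpha> \<le> c powr \<alpha>" if "0 \<le> c" "c \<le> s" for c
  proof -
    have "c / s \<le> (c / s) powr \<alpha>"
      using powr_mono'[of \<alpha> 1 "c / s"] that s \<open>\<alpha> \<le> 1\<close> by simp
    also have "\<dots> = c powr \<alpha> / s powr \<alpha>"
      using that s by (simp add: powr_divide)
    finally show ?thesis using s by (simp add: field_simps)
  qed
  have "s powr \<alpha> = a / s * s powr \<alpha> + b / s * s powr \<alpha>"
    using s by (simp add: s_def flip: distrib_right add_divide_distrib)
  also have "\<dots> \<le> a powr \<alpha> + b powr \<alpha>"
    using assms by (intro add_mono frac) (auto simp: s_def)
  finally show ?thesis by (simp add: s_def)
qed (use assms in auto)

lemma max_on_eqI: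
  assumes "x \<in> X" and "\<And>y. y \<in> X \<Longrightarrow> g y \<le> g x"
  shows "max_on X g = g x"
  unfolding max_on_def using assms by (intro Greatest_equality) auto

lemma holder_class_continuous_on:
  assumes "f \<in> holder_class X \<alpha>" "0 < \<alpha>"
  shows "continuous_on X f"
proof (unfold continuous_on_iff, intro ballI allI impI)
  fix x and e :: real assume x: "x \<in> X" and e: "0 < e"
  show "\<exists>d>0. \<forall>x'\<in>X. dist x' x < d \<longrightarrow> dist (f x') (f x) < e"
  \<comment> \<open>This radius is the preimage of e under the modulus t \<mapsto>
    \<open>t powr \<alpha>\<close>.\<close>
  proof (intro exI[of _ "e powr (1 / \<alpha>)"] conjI ballI impI)
    fix x' assume x': "x' \<in> X" and "dist x' x < e powr (1 / \<alpha>)"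
    then have "dist x' x powr \<alpha> < (e powr (1 / \<alpha>)) powr \<alpha>"
      using assms(2) by (intro powr_less_mono2) auto
    also have "\<dots> = e" using e assms(2) by (simp add: powr_powr)
    finally show "dist (f x') (f x) < e"
      using assms(1) x x' by (force simp: holder_class_def dist_real_def)
  qed (use e in simp)
qed

lemma holder_class_attains_max:
  assumes "f \<in> holder_class X \<alpha>" "0 < \<alpha>" "compact X" "X \<noteq> {}"
  obtains x where "x \<in> X" "max_on X f = f x" "\<forall>y\<in>X. f y \<le> f x"
proof -
  obtain x where x: "x \<in> X" "\<forall>y\<in>X. f y \<le> f x"
    using continuous_attains_sup[OF assms(3,4) holder_class_continuous_on[OF assms(1,2)]] by blast
  then have "max_on X f = f x" by (intro max_on_eqI) auto
  then show ?thesis using x by (intro that) auto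
qed

lemma min_dist_powr_le: "min_dist_powr \<alpha> p x \<le> dist x (p m) powr \<alpha>"
  by (simp add: min_dist_powr_def)

lemma min_dist_powr_attained:
  obtains m where "min_dist_powr \<alpha> p x = dist x (p m) powr \<alpha>"
proof -
  have "min_dist_powr \<alpha> p x \<in> range (\<lambda>m. dist x (p m) powr \<alpha>)"
    unfolding min_dist_powr_def by (intro Min_in) auto
  then show ?thesis using that by blast
qed

lemma min_dist_powr_nonneg: "0 \<le> min_dist_powr \<alpha> p x"
  by (metis min_dist_powr_attained powr_ge_zero)

lemma min_dist_powr_at_site: "min_dist_powr \<alpha> p (p m) = 0"
  \<comment> \<open>The site itself competes in the minimum, and \<open>0 powr \<alpha>\<close> is 0
    by the convention for \<open>powr\<close>.\<close>
  using min_dist_powr_le[of \<alpha> p "p m" m] min_dist_powr_nonneg[of \<alpha> p "p m"] by simp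

lemma min_dist_powr_diff_le:
  assumes "0 < \<alpha>" "\<alpha> \<le> 1"
  shows "min_dist_powr \<alpha> p x \<le> min_dist_powr \<alpha> p x' + dist x x' powr \<alpha>"
proof -
  obtain m where m: "min_dist_powr \<alpha> p x' = dist x' (p m) powr \<alpha>"
    by (rule min_dist_powr_attained)
  have "min_dist_powr \<alpha> p x \<le> dist x (p m) powr \<alpha>" by (rule min_dist_powr_le)
  also have "\<dots> \<le> (dist x x' + dist x' (p m)) powr \<alpha>"
    using assms by (intro powr_mono2 dist_triangle) auto
  also have "\<dots> \<le> dist x x' powr \<alpha> + dist x' (p m) powr \<alpha>"
    using assms by (intro powr_add_le_add_powr) auto
  finally show ?thesis using m by simp
qed

text \<open>The shift c = 0 makes the maximum of U attained; c = \<epsilon> yields the large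
  adversarial function of the lower bound.\<close>

lemma min_dist_powr_add_const_holder:
  assumes "0 < \<alpha>" "\<alpha> \<le> 1"
  shows "(\<lambda>x. min_dist_powr \<alpha> p x + c) \<in> holder_class X \<alpha>"
  unfolding holder_class_def
proof (intro CollectI ballI)
  fix x x'
  show "\<bar>min_dist_powr \<alpha> p x + c - (min_dist_powr \<alpha> p x' + c)\<bar> \<le> dist x x' powr \<alpha>"
    using min_dist_powr_diff_le[OF assms, of p x x'] min_dist_powr_diff_le[OF assms, of p x' x]
    by (simp add: dist_commute)
qed

lemma gwce_upper:
  fixes f :: "'a::metric_space \<Rightarrow> real"
  assumes "f \<in> holder_class X \<alpha>" "\<And>m. y $ m = f (p m) + e m" "\<And>m. \<bar>e m\<bar> \<le> \<epsilon>"
  shows "ereal \<bar>max_on X f - \<Delta> y\<bar> \<le> gwce X \<alpha> p \<epsilon> \<Delta>"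
  unfolding gwce_def using assms by (intro Sup_upper CollectI exI[of _ f] exI[of _ e] exI[of _ y]) auto

lemma gwce_glo_recovery_le:
  assumes "compact X" "X \<noteq> {}" "0 < \<alpha>" "\<alpha> \<le> 1" and p: "\<And>m. p m \<in> X"
  shows "gwce X \<alpha> p \<epsilon> (glo_recovery X \<alpha> p)
    \<le> ereal (max_on X (min_dist_powr \<alpha> p) / 2 + \<epsilon>)"
  unfolding gwce_def
proof (rule Sup_least, clarify)
  fix f e and y :: "real ^ 'b"
  assume f: "f \<in> holder_class X \<alpha>" and y: "\<forall>m. y $ m = f (p m) + e m \<and> \<bar>e m\<bar> \<le> \<epsilon>"
  define U where "U = max_on X (min_dist_powr \<alpha> p)"
  define Y where "Y = Max (range (\<lambda>m. y $ m))"
  \<comment> \<open>Membership provides a maximizer, so that \<open>max_on\<close> really bounds U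
    on X.\<close>
  have "min_dist_powr \<alpha> p \<in> holder_class X \<alpha>"
    using min_dist_powr_add_const_holder[OF assms(3,4), of p 0] by simp
  then obtain w where w: "w \<in> X" "U = min_dist_powr \<alpha> p w"
      "\<forall>x\<in>X. min_dist_powr \<alpha> p x \<le> min_dist_powr \<alpha> p w"
    unfolding U_def by (rule holder_class_attains_max[OF _ assms(3,1,2)])
  have U: "min_dist_powr \<alpha> p x \<le> U" if "x \<in> X" for x
    using w that by simp
  obtain z where z: "z \<in> X" "max_on X f = f z" "\<forall>y\<in>X. f y \<le> f z"
    by (rule holder_class_attains_max[OF f assms(3,1,2)])
  \<comment> \<open>At a site nearest to the maximizer z, f has dropped by at most U(z), hence by at
    most max U.\<close>
  obtain m where m: "min_dist_powr \<alpha> p z = dist z (p m) powr \<alpha>"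
    by (rule min_dist_powr_attained)
  have "f z - f (p m) \<le> U"
    using f z(1) p[of m] U[OF z(1)] m by (force simp: holder_class_def)
  moreover have "y $ m \<le> Y" unfolding Y_def by simp
  ultimately have upper: "f z \<le> Y + \<epsilon> + U"
    using spec[OF y, of m] by linarith
  \<comment> \<open>At the site k with the largest datum, f is at least Y - \<epsilon>, and f(z)
    dominates that value.\<close>
  have "Y \<in> range (\<lambda>m. y $ m)" unfolding Y_def by (intro Max_in) auto
  then obtain k where "Y = y $ k" by blast
  then have "Y - \<epsilon> \<le> f z"
    using spec[OF y, of k] bspec[OF z(3) p, of k] by linarith
  then have "\<bar>f z - (Y + U / 2)\<bar> \<le> U / 2 + \<epsilon>" using upper by linarith
  then show "ereal \<bar>max_on X f - glo_recovery X \<alpha> p y\<bar>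
      \<le> ereal (max_on X (min_dist_powr \<alpha> p) / 2 + \<epsilon>)"
    by (simp add: z(2) glo_recovery_def U_def Y_def)
qed

lemma gwce_ge:
  fixes p :: "'m::finite \<Rightarrow> 'a::metric_space"
  assumes "compact X" "X \<noteq> {}" "0 < \<alpha>" "\<alpha> \<le> 1" "0 \<le> \<epsilon>"
  shows "ereal (max_on X (min_dist_powr \<alpha> p) / 2 + \<epsilon>) \<le> gwce X \<alpha> p \<epsilon> \<Delta>"
proof -
  define U where "U = min_dist_powr \<alpha> p"
  have holder: "(\<lambda>x. U x + c) \<in> holder_class X \<alpha>" for c
    unfolding U_def using assms by (intro min_dist_powr_add_const_holder)
  have "U \<in> holder_class X \<alpha>" using holder[of 0] by simp
  then obtain x where x: "x \<in> X" "max_on X U = U x" "\<forall>y\<in>X. U y \<le> U x"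
    by (rule holder_class_attains_max[OF _ assms(3,1,2)])
  have "max_on X (\<lambda>x. U x + \<epsilon>) = U x + \<epsilon>"
    using x by (intro max_on_eqI) auto
  \<comment> \<open>U vanishes at the sites, so the error -\<epsilon> cancels the shift and the data
    are 0.\<close>
  then have hi: "ereal \<bar>U x + \<epsilon> - \<Delta> 0\<bar> \<le> gwce X \<alpha> p \<epsilon> \<Delta>"
    using gwce_upper[OF holder[of \<epsilon>], of 0 p "\<lambda>_. - \<epsilon>" \<epsilon> \<Delta>] assms
    by (simp add: U_def min_dist_powr_at_site)
  have "max_on X (\<lambda>_. - \<epsilon>) = - \<epsilon>"
    using x(1) by (rule max_on_eqI) simp
  then have lo: "ereal \<bar>- \<epsilon> - \<Delta> 0\<bar> \<le> gwce X \<alpha> p \<epsilon> \<Delta>"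
    using gwce_upper[of "\<lambda>_. - \<epsilon>" X \<alpha> 0 p "\<lambda>_. \<epsilon>" \<epsilon> \<Delta>] assms
    by (simp add: holder_class_def)
  \<comment> \<open>Whatever \<open>\<Delta> 0\<close> is, it lies at least half the gap U(x) +
    2\<epsilon> away from one of the two maxima.\<close>
  have "U x / 2 + \<epsilon> \<le> max \<bar>U x + \<epsilon> - \<Delta> 0\<bar> \<bar>- \<epsilon> - \<Delta> 0\<bar>" by linarith
  then have "ereal (U x / 2 + \<epsilon>) \<le> max (ereal \<bar>U x + \<epsilon> - \<Delta> 0\<bar>) (ereal \<bar>- \<epsilon> - \<Delta> 0\<bar>)"
    by (simp add: le_max_iff_disj)
  also have "\<dots> \<le> gwce X \<alpha> p \<epsilon> \<Delta>" using hi lo by simp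
  finally show ?thesis using x(2) by (simp add: U_def)
qed

theorem theorem4:
  fixes X :: "'a::metric_space set" and p :: "'m::finite \<Rightarrow> 'a" and \<alpha> \<epsilon> :: real
  assumes "compact X" and "X \<noteq> {}"
    and "0 < \<alpha>" and "\<alpha> \<le> 1"
    and "\<And>m. p m \<in> X"
    and "0 \<le> \<epsilon>"
  shows "(INF \<Delta>. gwce X \<alpha> p \<epsilon> \<Delta>) = ereal (max_on X (min_dist_powr \<alpha> p) / 2 + \<epsilon>)
    \<and> gwce X \<alpha> p \<epsilon> (glo_recovery X \<alpha> p) = (INF \<Delta>. gwce X \<alpha> p \<epsilon> \<Delta>)"
proof -
  let ?v = "ereal (max_on X (min_dist_powr \<alpha> p) / 2 + \<epsilon>)"
  have lower: "?v \<le> gwce X \<alpha> p \<epsilon> \<Delta>" for \<Delta>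
    using assms by (intro gwce_ge)
  \<comment> \<open>The bound valid for every map holds for this one too, so its upper bound is an
    equality and the infimum is attained.\<close>
  have glo: "gwce X \<alpha> p \<epsilon> (glo_recovery X \<alpha> p) = ?v"
    using gwce_glo_recovery_le[of X \<alpha> p \<epsilon>] lower assms by (intro antisym) auto
  have "(INF \<Delta>. gwce X \<alpha> p \<epsilon> \<Delta>) = ?v"
    using lower glo by (intro antisym INF_greatest INF_lower2[of "glo_recovery X \<alpha> p"]) auto
  then show ?thesis using glo by simp
qed

end
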